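(* Let $$\mathcal{A}:=\Big\{\alpha\in\mathbb{R}^N:\ \alpha_1=0,\ \alpha_N=1,\ \alpha_1\le\cdots\le\alpha_N,\ 0\le\tfrac{\alpha_{j+1}-\alpha_j}{y_{j+1}-y_j}\le\tfrac{\alpha_j-\alpha_{j-1}}{y_j-y_{j-1}}\le L,\ j=2,\dots,N-1\Big\}$$ and $\bar p:=\sum_{k=1}^K Z_kp^k\in\mathbb{R}^N$. Consider the convex program $(\mathrm{P})$ defined in the context. Then: (i) $\gamma^*=0$ is optimal for $(\mathrm{P})$ (i.e. $(\mathrm{P})$ has an optimal solution with $\gamma=0$), equivalently there exists no $u\in\mathcal{U}_c$ with $\sum_{k=1}^K Z_k(\mathbb{E}[u(W_k)]-\mathbb{E}[u(Y_k)])>0$, if and only if $$\max_{\alpha\in\mathcal{A}}\ \bar p^\top\alpha\le 0.$$ (ii) Equivalently, the optimal $\gamma^*$ is positive (i.e. $\gamma=0$ is not optimal for $(\mathrm{P})$) if and only if $\max_{\alpha\in\mathcal{A}}\bar p^\top\alpha>0$. (iii) In particular, if $\bar p_j\le 0$ for all $j=1,\dots,N$, then $\gamma^*=0$ is optimal for $(\mathrm{P})$.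
   Context: Fix constants $\bar b>0$, $L>0$, $\bar c>0$. $\mathcal{U}_c$ is the set of all functions $u:[0,\bar b]\to\mathbb{R}$ that are monotonically increasing (in the weak sense, i.e. nondecreasing), concave, Lipschitz continuous with modulus at most $L$, and satisfy $u(0)=0$, $u(\bar b)=1$. It is a standing assumption that $\mathcal{U}_c$ is nonempty. A dataset $D=\{(W_k,Y_k,Z_k): k=1,\dots,K\}$ is given, where $W_k,Y_k$ are random variables (lotteries) with finite support contained in $[0,\bar b]$ and $Z_k\in\{1,-1\}$. Let $\mathbb{Y}=\{y_1<\dots<y_N\}$ be the ordered list of all points of $\{0,\bar b\}\cup\bigcup_k \mathrm{supp}(W_k)\cup\bigcup_k\mathrm{supp}(Y_k)$, so $y_1=0$, $y_N=\bar b$. Put $p^k=(p^k_1,\dots,p^k_N)^\top$ with $p^k_j=\mathbb{P}[W_k=y_j]-\mathbb{P}[Y_k=y_j]$. Program $(\mathrm{P})$: maximize $-\sum_{k=1}^K\log\big[1+\exp\big(\sum_{j=1}^N -Z_kp^k_j\bar\alpha_j\big)\big]$ over $\bar\alpha\in\mathbb{R}^N$, $\bar\beta\in\mathbb{R}^{N-1}$, $\gamma\in[0,\bar c]$ subject to $\bar\beta_j=(\bar\alpha_{j+1}-\bar\alpha_j)/(y_{j+1}-y_j)$ for $j=1,\dots,N-1$; $\bar\beta_{j+1}\le\bar\beta_j$ for $j=1,\dots,N-2$; $\bar\beta_1\le L\gamma$; $\bar\beta_{N-1}\ge0$; $\bar\alpha_1=0$; $\bar\alpha_N=\gamma$. Here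 $\gamma^*$ denotes the $\gamma$-component of an optimal solution. *)

theory Defs
  imports "HOL-Probability.Probability"
begin

definition U_c :: "real \<Rightarrow> real \<Rightarrow> (real \<Rightarrow> real) set" where
  "U_c b L = {u. mono_on {0..b} u \<and> concave_on {0..b} u \<and> L-lipschitz_on {0..b} u
                 \<and> u 0 = 0 \<and> u b = 1}"

definition grid :: "real \<Rightarrow> nat \<Rightarrow> (nat \<Rightarrow> real pmf) \<Rightarrow> (nat \<Rightarrow> real pmf) \<Rightarrow> real list" where
  "grid b K W Y = sorted_list_of_set
     ({0, b} \<union> (\<Union>k\<in>{1..K}. set_pmf (W k)) \<union> (\<Union>k\<in>{1..K}. set_pmf (Y k)))"

text \<open>Indices run from 1: the point \<open>y\<^sub>j\<close> is the list element at position \<open>j - 1\<close>.\<close>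

definition pt :: "real list \<Rightarrow> nat \<Rightarrow> real" where
  "pt ys j = ys ! (j - 1)"

text \<open>Vectors with \<open>n\<close> real entries are extensional functions on \<open>{1..n}\<close>.\<close>

definition vecs :: "nat \<Rightarrow> (nat \<Rightarrow> real) set" where
  "vecs n = {1..n} \<rightarrow>\<^sub>E UNIV"

definition pdiff :: "(nat \<Rightarrow> real pmf) \<Rightarrow> (nat \<Rightarrow> real pmf) \<Rightarrow> real list \<Rightarrow> nat \<Rightarrow> nat \<Rightarrow> real" where
  "pdiff W Y ys k j = pmf (W k) (pt ys j) - pmf (Y k) (pt ys j)"

definition pbar :: "nat \<Rightarrow> (nat \<Rightarrow> real pmf) \<Rightarrow> (nat \<Rightarrow> real pmf) \<Rightarrow> (nat \<Rightarrow> real)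
    \<Rightarrow> real list \<Rightarrow> nat \<Rightarrow> real" where
  "pbar K W Y Z ys j = (\<Sum>k=1..K. Z k * pdiff W Y ys k j)"

definition slope :: "real list \<Rightarrow> (nat \<Rightarrow> real) \<Rightarrow> nat \<Rightarrow> real" where
  "slope ys \<alpha> j = (\<alpha> (j + 1) - \<alpha> j) / (pt ys (j + 1) - pt ys j)"

definition \<A> :: "real \<Rightarrow> real list \<Rightarrow> (nat \<Rightarrow> real) set" where
  "\<A> L ys = (let N = length ys in
     {\<alpha> \<in> vecs N. \<alpha> 1 = 0 \<and> \<alpha> N = 1 \<and> (\<forall>j\<in>{1..N-1}. \<alpha> j \<le> \<alpha> (j + 1)) \<and>
        (\<forall>j\<in>{2..N-1}. 0 \<le> slope ys \<alpha> j \<and> slope ys \<alpha> j \<le> slope ys \<alpha> (j - 1) \<and>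
                        slope ys \<alpha> (j - 1) \<le> L)})"

definition P_objective :: "nat \<Rightarrow> (nat \<Rightarrow> real pmf) \<Rightarrow> (nat \<Rightarrow> real pmf) \<Rightarrow> (nat \<Rightarrow> real)
    \<Rightarrow> real list \<Rightarrow> (nat \<Rightarrow> real) \<times> (nat \<Rightarrow> real) \<times> real \<Rightarrow> real" where
  "P_objective K W Y Z ys = (\<lambda>(\<alpha>, \<beta>, \<gamma>).
     - (\<Sum>k=1..K. ln (1 + exp (\<Sum>j=1..length ys. - Z k * pdiff W Y ys k j * \<alpha> j))))"

definition P_feasible :: "real \<Rightarrow> real \<Rightarrow> real list
    \<Rightarrow> ((nat \<Rightarrow> real) \<times> (nat \<Rightarrow> real) \<times> real) set" where
  "P_feasible L c ys = (let N = length ys in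
     {(\<alpha>, \<beta>, \<gamma>). \<alpha> \<in> vecs N \<and> \<beta> \<in> vecs (N - 1) \<and> \<gamma> \<in> {0..c} \<and>
        (\<forall>j\<in>{1..N-1}. \<beta> j = slope ys \<alpha> j) \<and>
        (\<forall>j\<in>{1..N-2}. \<beta> (j + 1) \<le> \<beta> j) \<and>
        \<beta> 1 \<le> L * \<gamma> \<and> \<beta> (N - 1) \<ge> 0 \<and> \<alpha> 1 = 0 \<and> \<alpha> N = \<gamma>})"

definition P_optimal :: "real \<Rightarrow> real \<Rightarrow> nat \<Rightarrow> (nat \<Rightarrow> real pmf) \<Rightarrow> (nat \<Rightarrow> real pmf)
    \<Rightarrow> (nat \<Rightarrow> real) \<Rightarrow> real list \<Rightarrow> (nat \<Rightarrow> real) \<times> (nat \<Rightarrow> real) \<times> real \<Rightarrow> bool" where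
  "P_optimal L c K W Y Z ys = is_arg_max (P_objective K W Y Z ys) (\<lambda>x. x \<in> P_feasible L c ys)"

definition pbar_dot :: "nat \<Rightarrow> (nat \<Rightarrow> real pmf) \<Rightarrow> (nat \<Rightarrow> real pmf) \<Rightarrow> (nat \<Rightarrow> real)
    \<Rightarrow> real list \<Rightarrow> (nat \<Rightarrow> real) \<Rightarrow> real" where
  "pbar_dot K W Y Z ys \<alpha> = (\<Sum>j=1..length ys. pbar K W Y Z ys j * \<alpha> j)"

definition max_pbar :: "real \<Rightarrow> nat \<Rightarrow> (nat \<Rightarrow> real pmf) \<Rightarrow> (nat \<Rightarrow> real pmf) \<Rightarrow> (nat \<Rightarrow> real)
    \<Rightarrow> real list \<Rightarrow> real" where
  "max_pbar L K W Y Z ys = (GREATEST v. v \<in> pbar_dot K W Y Z ys ` \<A> L ys)"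

end

theory Submission imports Defs begin

text \<open>
  The feasible vectors \<open>\<alpha>\<close> form a cone \<open>C\<close> (nonnegative nonincreasing slopes, first slope at most
  \<open>L * \<alpha>\<^sub>N\<close>), in which \<open>\<gamma>\<close> is the last coordinate and \<open>\<A>\<close> is the slice \<open>\<alpha>\<^sub>N = 1\<close>.
  The objective is concave along rays of \<open>C\<close>, and its derivative at the origin in direction
  \<open>\<alpha>\<close> is half of \<open>p \<bullet> \<alpha>\<close>, where \<open>p\<close> is the vector \<open>pbar\<close>; hence the origin is optimal iff
  \<open>p \<bullet> \<alpha> \<le> 0\<close> on \<open>\<A>\<close>.
  Restriction to the grid maps \<open>U_c\<close> onto \<open>\<A>\<close>, because each \<open>\<alpha> \<in> \<A>\<close> is interpolated by the
  minimum of the affine functions through consecutive points of its graph.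
\<close>

definition utility_cone :: "real \<Rightarrow> real list \<Rightarrow> (nat \<Rightarrow> real) set" where
  "utility_cone L ys = (let N = length ys in
     {\<alpha> \<in> vecs N. \<alpha> 1 = 0 \<and> (\<forall>j\<in>{1..N-2}. slope ys \<alpha> (j + 1) \<le> slope ys \<alpha> j) \<and>
        slope ys \<alpha> 1 \<le> L * \<alpha> N \<and> 0 \<le> slope ys \<alpha> (N - 1)})"

locale knots =
  fixes ys :: "real list" and b :: real
  assumes sorted: "sorted_wrt (<) ys"
    and two_points: "2 \<le> length ys"
    and first_point: "pt ys 1 = 0"
    and last_point: "pt ys (length ys) = b"
begin

abbreviation "N \<equiv> length ys"

lemma length_minus [simp]: "Suc (N - Suc 0) = N" "Suc 0 \<le> N - Suc 0" "N - Suc 0 < N"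
  using two_points by linarith+

lemma pt_less: "1 \<le> i \<Longrightarrow> i < j \<Longrightarrow> j \<le> N \<Longrightarrow> pt ys i < pt ys j"
  unfolding pt_def by (rule sorted_wrt_nth_less[OF sorted]) auto

lemma pt_le: "1 \<le> i \<Longrightarrow> i \<le> j \<Longrightarrow> j \<le> N \<Longrightarrow> pt ys i \<le> pt ys j"
  using pt_less[of i j] by (cases "i = j") auto

lemma pt_mem: "1 \<le> i \<Longrightarrow> i \<le> N \<Longrightarrow> pt ys i \<in> {0..b}"
  using pt_le[of 1 i] pt_le[of i N] first_point last_point by auto

lemma value_Suc:
  assumes "1 \<le> j" "j < N"
  shows "\<alpha> (Suc j) = \<alpha> j + slope ys \<alpha> j * (pt ys (Suc j) - pt ys j)"
  using pt_less[of j "Suc j"] assms by (simp add: slope_def)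

lemma slope_antimono:
  assumes "\<alpha> \<in> utility_cone L ys" "1 \<le> i" "i \<le> j" "j < N"
  shows "slope ys \<alpha> j \<le> slope ys \<alpha> i"
  using \<open>i \<le> j\<close> \<open>j < N\<close>
proof (induction j rule: dec_induct)
  case (step j)
  have "slope ys \<alpha> (j + 1) \<le> slope ys \<alpha> j"
    using assms(1,2) step by (auto simp: utility_cone_def Let_def)
  with step show ?case by simp
qed simp

lemma slope_nonneg:
  assumes "\<alpha> \<in> utility_cone L ys" "1 \<le> j" "j < N"
  shows "0 \<le> slope ys \<alpha> j"
proof -
  have "slope ys \<alpha> (N - 1) \<le> slope ys \<alpha> j"
    using slope_antimono[OF assms(1), of j "N - 1"] assms two_points by auto
  then show ?thesis using assms(1) by (auto simp: utility_cone_def Let_def)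
qed

lemma slope_le:
  assumes "\<alpha> \<in> utility_cone L ys" "1 \<le> j" "j < N"
  shows "slope ys \<alpha> j \<le> L * \<alpha> N"
  using slope_antimono[OF assms(1), of 1 j] assms by (auto simp: utility_cone_def Let_def)

lemma value_mono:
  assumes "\<alpha> \<in> utility_cone L ys" "1 \<le> i" "i \<le> j" "j \<le> N"
  shows "\<alpha> i \<le> \<alpha> j"
  using \<open>i \<le> j\<close> \<open>j \<le> N\<close>
proof (induction j rule: dec_induct)
  case (step j)
  have "0 \<le> slope ys \<alpha> j * (pt ys (Suc j) - pt ys j)"
    using slope_nonneg[OF assms(1), of j] pt_less[of j "Suc j"] assms(2) step by auto
  then show ?case using value_Suc[of j \<alpha>] assms(2) step by auto
qed simp

lemma value_bounds:
  assumes "\<alpha> \<in> utility_cone L ys" "1 \<le> i" "i \<le> N"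
  shows "0 \<le> \<alpha> i" "\<alpha> i \<le> \<alpha> N"
  using value_mono[OF assms(1), of 1 i] value_mono[OF assms(1), of i N] assms
  by (auto simp: utility_cone_def Let_def)

lemma value_le_line:
  assumes "\<alpha> \<in> utility_cone L ys" "1 \<le> i" "i \<le> N" "1 \<le> j" "j < N"
  shows "\<alpha> i \<le> \<alpha> j + slope ys \<alpha> j * (pt ys i - pt ys j)"
proof (cases "j \<le> i")
  case True
  then show ?thesis using \<open>i \<le> N\<close>
  proof (induction i rule: dec_induct)
    case (step i)
    have "slope ys \<alpha> i * (pt ys (Suc i) - pt ys i) \<le> slope ys \<alpha> j * (pt ys (Suc i) - pt ys i)"
      using slope_antimono[OF assms(1), of j i] pt_less[of i "Suc i"] assms(4) step
      by (intro mult_right_mono) auto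
    then show ?case
      using step value_Suc[of i \<alpha>] assms(4) by (auto simp: algebra_simps)
  qed simp
next
  case False
  then have "i \<le> j" by simp
  then show ?thesis using \<open>1 \<le> i\<close>
  proof (induction i rule: inc_induct)
    case (step i)
    have "slope ys \<alpha> j * (pt ys (Suc i) - pt ys i) \<le> slope ys \<alpha> i * (pt ys (Suc i) - pt ys i)"
      using slope_antimono[OF assms(1), of i j] pt_less[of i "Suc i"] assms(5) step
      by (intro mult_right_mono) auto
    then show ?case
      using step value_Suc[of i \<alpha>] assms(5) by (auto simp: algebra_simps)
  qed simp
qed

lemma slope_scaled:
  assumes "1 \<le> j" "j < N"
  shows "slope ys (restrict (\<lambda>j. s * \<alpha> j) {1..N}) j = s * slope ys \<alpha> j"
  using assms by (simp add: slope_def right_diff_distrib diff_divide_distrib)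

lemma scaled_mem_cone:
  assumes "\<alpha> \<in> utility_cone L ys" "0 \<le> s"
  shows "restrict (\<lambda>j. s * \<alpha> j) {1..N} \<in> utility_cone L ys"
proof -
  let ?\<alpha> = "restrict (\<lambda>j. s * \<alpha> j) {1..N}"
  have "slope ys ?\<alpha> (j + 1) \<le> slope ys ?\<alpha> j" if "j \<in> {1..N-2}" for j
    using that slope_antimono[OF assms(1), of j "j + 1"] assms(2)
    by (subst (1 2) slope_scaled) (auto intro: mult_left_mono)
  moreover have "slope ys ?\<alpha> 1 \<le> L * ?\<alpha> N"
    using slope_le[OF assms(1), of 1] assms(2) two_points mult_left_mono[of "slope ys \<alpha> 1" "L * \<alpha> N" s]
    by (subst slope_scaled) (auto simp: mult.left_commute)
  moreover have "0 \<le> slope ys ?\<alpha> (N - 1)"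
    using slope_nonneg[OF assms(1), of "N - 1"] assms(2) two_points by (subst slope_scaled) auto
  moreover have "?\<alpha> \<in> vecs N" "?\<alpha> 1 = 0"
    using assms(1) two_points by (auto simp: vecs_def utility_cone_def Let_def)
  ultimately show ?thesis by (simp add: utility_cone_def Let_def)
qed

lemma zero_mem_cone: "restrict (\<lambda>_. 0) {1..N} \<in> utility_cone L ys"
  using two_points by (auto simp: utility_cone_def Let_def vecs_def slope_def)

lemma mem_A_iff:
  assumes "1 \<le> L * b"
  shows "\<alpha> \<in> \<A> L ys \<longleftrightarrow> \<alpha> \<in> utility_cone L ys \<and> \<alpha> N = 1"
proof (intro iffI conjI)
  assume \<alpha>: "\<alpha> \<in> \<A> L ys"
  then show 1: "\<alpha> N = 1" by (auto simp: \<A>_def Let_def)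
  have mono: "\<alpha> j \<le> \<alpha> (j + 1)" if "1 \<le> j" "j < N" for j
    using \<alpha> that by (auto simp: \<A>_def Let_def)
  have "0 \<le> slope ys \<alpha> (N - 1)"
    using mono[of "N - 1"] pt_less[of "N - 1" N] two_points by (auto simp: slope_def)
  moreover have "slope ys \<alpha> (j + 1) \<le> slope ys \<alpha> j" if "j \<in> {1..N-2}" for j
  proof -
    have "j + 1 \<in> {2..N-1}" using that by auto
    with \<alpha> have "slope ys \<alpha> (j + 1) \<le> slope ys \<alpha> (j + 1 - 1)" unfolding \<A>_def Let_def by blast
    then show ?thesis by simp
  qed
  moreover have "slope ys \<alpha> 1 \<le> L * \<alpha> N"
  proof (cases "N = 2")
    case True
    have "0 < b" using pt_less[of 1 N] first_point last_point two_points by simp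
    with True \<alpha> assms 1 first_point last_point show ?thesis
      by (auto simp: slope_def \<A>_def Let_def numeral_2_eq_2 field_simps)
  next
    case False
    then have "2 \<in> {2..N-1}" using two_points by auto
    with \<alpha> have "slope ys \<alpha> (2 - 1) \<le> L" unfolding \<A>_def Let_def by blast
    then show ?thesis using 1 by simp
  qed
  ultimately show "\<alpha> \<in> utility_cone L ys"
    using \<alpha> by (auto simp: \<A>_def utility_cone_def Let_def)
next
  assume "\<alpha> \<in> utility_cone L ys \<and> \<alpha> N = 1"
  then have \<alpha>: "\<alpha> \<in> utility_cone L ys" and 1: "\<alpha> N = 1" by auto
  have "\<alpha> j \<le> \<alpha> (j + 1)" if "j \<in> {1..N-1}" for j
    using value_mono[OF \<alpha>, of j "j + 1"] that by auto
  moreover have "0 \<le> slope ys \<alpha> j \<and> slope ys \<alpha> j \<le> slope ys \<alpha> (j - 1) \<and> slope ys \<alpha> (j - 1) \<le> L"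
    if "j \<in> {2..N-1}" for j
    using slope_nonneg[OF \<alpha>, of j] slope_antimono[OF \<alpha>, of "j - 1" j]
      slope_le[OF \<alpha>, of "j - 1"] that 1 by auto
  ultimately show "\<alpha> \<in> \<A> L ys"
    using \<alpha> 1 by (auto simp: \<A>_def utility_cone_def Let_def)
qed

lemma mem_P_feasible_iff:
  "(\<alpha>, \<beta>, \<gamma>) \<in> P_feasible L c ys \<longleftrightarrow>
     \<alpha> \<in> utility_cone L ys \<and> \<alpha> N \<in> {0..c} \<and> \<beta> = restrict (slope ys \<alpha>) {1..N-1} \<and> \<gamma> = \<alpha> N"
    (is "?l \<longleftrightarrow> ?r")
proof
  assume l: ?l
  have "\<beta> \<in> vecs (N - 1)" "\<forall>j\<in>{1..N-1}. \<beta> j = slope ys \<alpha> j"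
    using l by (auto simp: P_feasible_def Let_def)
  then have "\<beta> = restrict (slope ys \<alpha>) {1..N-1}"
    by (auto simp: fun_eq_iff vecs_def PiE_iff extensional_def restrict_def)
  moreover have "1 \<in> {1..N-1}" "N - 1 \<in> {1..N-1}" using two_points by auto
  moreover have "slope ys \<alpha> (j + 1) \<le> slope ys \<alpha> j" if "j \<in> {1..N-2}" for j
  proof -
    have "j \<in> {1..N-1}" "j + 1 \<in> {1..N-1}" using that by auto
    then have "\<beta> (j + 1) = slope ys \<alpha> (j + 1)" "\<beta> j = slope ys \<alpha> j"
      using \<open>\<forall>j\<in>{1..N-1}. \<beta> j = slope ys \<alpha> j\<close> by blast+
    moreover have "\<beta> (j + 1) \<le> \<beta> j" using l that by (simp add: P_feasible_def Let_def)
    ultimately show ?thesis by simp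
  qed
  ultimately show ?r using l by (auto simp: P_feasible_def Let_def utility_cone_def)
next
  assume r: ?r
  have "1 \<in> {1..N-1}" "N - 1 \<in> {1..N-1}" using two_points by auto
  moreover have "\<beta> (j + 1) \<le> \<beta> j" if "j \<in> {1..N-2}" for j
  proof -
    have "j \<in> {1..N-1}" "j + 1 \<in> {1..N-1}" using that by auto
    with r that show ?thesis by (simp add: utility_cone_def Let_def)
  qed
  ultimately show ?l using r by (auto simp: P_feasible_def Let_def utility_cone_def vecs_def)
qed

lemma cone_eq_zero:
  assumes "\<alpha> \<in> utility_cone L ys" "\<alpha> N = 0" "j \<in> {1..N}"
  shows "\<alpha> j = 0"
  using value_bounds[OF assms(1), of j] assms by auto

lemma compact_cone_slice:
  fixes S :: "real set"
  assumes "compact S"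
  shows "compact (utility_cone L ys \<inter> {\<alpha>. \<alpha> N \<in> S})"
proof -
  obtain c where c: "\<And>x. x \<in> S \<Longrightarrow> x \<le> c"
    using compact_imp_bounded[OF assms] by (auto simp: bounded_real abs_le_iff)
  define B where "B = (\<lambda>i. if i \<in> {1..N} then {0..c} else {undefined :: real})"
  have "compactin (product_topology (\<lambda>i. euclidean) UNIV) (PiE UNIV B)"
    unfolding compactin_PiE by (auto simp: B_def)
  then have B: "compact (PiE UNIV B)"
    by (simp add: euclidean_product_topology)
  have coord: "continuous_on UNIV (\<lambda>\<alpha>::nat \<Rightarrow> real. \<alpha> i)" for i by simp
  have slope: "continuous_on UNIV (\<lambda>\<alpha>. slope ys \<alpha> i)" for i
    unfolding slope_def divide_inverse by (intro continuous_intros coord)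
  define F where "F = (\<Inter>j\<in>{1..N-2}. {\<alpha>. slope ys \<alpha> (j + 1) \<le> slope ys \<alpha> j}) \<inter> {\<alpha>. \<alpha> 1 = 0} \<inter>
      {\<alpha>. slope ys \<alpha> 1 \<le> L * \<alpha> N} \<inter> {\<alpha>. 0 \<le> slope ys \<alpha> (N - 1)} \<inter> {\<alpha>. \<alpha> N \<in> S}"
  have "closed {\<alpha>::nat \<Rightarrow> real. \<alpha> N \<in> S}"
    using closed_vimage[OF compact_imp_closed[OF assms] coord[of N]] by (simp add: vimage_def)
  then have "closed F" unfolding F_def
    by (intro closed_Int closed_INT ballI closed_Collect_le closed_Collect_eq
        continuous_intros coord slope)
  moreover have "utility_cone L ys \<inter> {\<alpha>. \<alpha> N \<in> S} = PiE UNIV B \<inter> F"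
  proof (intro equalityI subsetI)
    fix \<alpha> assume \<alpha>: "\<alpha> \<in> utility_cone L ys \<inter> {\<alpha>. \<alpha> N \<in> S}"
    have "\<alpha> i \<in> B i" for i
    proof (cases "i \<in> {1..N}")
      case True
      then show ?thesis using value_bounds[of \<alpha> L i] \<alpha> c[of "\<alpha> N"] by (auto simp: B_def)
    next
      case False
      then show ?thesis using \<alpha> by (auto simp: B_def utility_cone_def Let_def vecs_def PiE_def extensional_def)
    qed
    then show "\<alpha> \<in> PiE UNIV B \<inter> F"
      using \<alpha> by (auto simp: F_def utility_cone_def Let_def)
  next
    fix \<alpha> assume \<alpha>: "\<alpha> \<in> PiE UNIV B \<inter> F"
    have "\<alpha> i = undefined" if "i \<notin> {1..N}" for i
    proof -
      have "\<alpha> i \<in> B i" using \<alpha> by auto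
      then show ?thesis using that unfolding B_def by (simp only: if_False singleton_iff)
    qed
    then have "\<alpha> \<in> vecs N" by (auto simp: vecs_def PiE_def extensional_def)
    then show "\<alpha> \<in> utility_cone L ys \<inter> {\<alpha>. \<alpha> N \<in> S}"
      using \<alpha> by (auto simp: F_def utility_cone_def Let_def)
  qed
  ultimately show ?thesis using B by (simp add: compact_Int_closed)
qed

definition interp :: "(nat \<Rightarrow> real) \<Rightarrow> real \<Rightarrow> real" where
  "interp \<alpha> x = (MIN j\<in>{1..N-1}. \<alpha> j + slope ys \<alpha> j * (x - pt ys j))"

lemma interp_le: "j \<in> {1..N-1} \<Longrightarrow> interp \<alpha> x \<le> \<alpha> j + slope ys \<alpha> j * (x - pt ys j)"
  unfolding interp_def by (intro Min_le) auto

lemma interp_attained: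
  obtains j where "j \<in> {1..N-1}" "interp \<alpha> x = \<alpha> j + slope ys \<alpha> j * (x - pt ys j)"
proof -
  have "interp \<alpha> x \<in> (\<lambda>j. \<alpha> j + slope ys \<alpha> j * (x - pt ys j)) ` {1..N-1}"
    unfolding interp_def using two_points by (intro Min_in) auto
  then show ?thesis using that by blast
qed

lemma interp_pt:
  assumes "\<alpha> \<in> utility_cone L ys" "i \<in> {1..N}"
  shows "interp \<alpha> (pt ys i) = \<alpha> i"
proof (rule antisym)
  show "interp \<alpha> (pt ys i) \<le> \<alpha> i"
  proof (cases "i = N")
    case True
    then show ?thesis
      using interp_le[of "N - 1" \<alpha> "pt ys i"] value_Suc[of "N - 1" \<alpha>] two_points by auto
  next
    case False
    then show ?thesis using interp_le[of i \<alpha> "pt ys i"] assms by auto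
  qed
  obtain j where "j \<in> {1..N-1}" "interp \<alpha> (pt ys i) = \<alpha> j + slope ys \<alpha> j * (pt ys i - pt ys j)"
    by (rule interp_attained)
  then show "\<alpha> i \<le> interp \<alpha> (pt ys i)"
    using value_le_line[OF assms(1), of i j] assms by auto
qed

lemma interp_mem_U_c:
  assumes \<alpha>: "\<alpha> \<in> utility_cone L ys" and N: "\<alpha> N = 1" and "0 < L"
  shows "interp \<alpha> \<in> U_c b L"
proof -
  have "interp \<alpha> x \<le> interp \<alpha> y" if "x \<le> y" for x y
  proof -
    obtain j where j: "j \<in> {1..N-1}" "interp \<alpha> y = \<alpha> j + slope ys \<alpha> j * (y - pt ys j)"
      by (rule interp_attained)
    have "slope ys \<alpha> j * (x - pt ys j) \<le> slope ys \<alpha> j * (y - pt ys j)"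
      using slope_nonneg[OF \<alpha>, of j] that j by (intro mult_left_mono) auto
    then show ?thesis using interp_le[OF j(1), of \<alpha> x] j by linarith
  qed
  then have "mono_on {0..b} (interp \<alpha>)" by (auto intro: mono_onI)
  moreover have "concave_on {0..b} (interp \<alpha>)"
  proof (unfold concave_on_iff, intro conjI ballI allI impI)
    fix x y u v :: real
    assume uv: "0 \<le> u" "0 \<le> v" "u + v = 1"
    obtain j where j: "j \<in> {1..N-1}"
        "interp \<alpha> (u *\<^sub>R x + v *\<^sub>R y) = \<alpha> j + slope ys \<alpha> j * (u *\<^sub>R x + v *\<^sub>R y - pt ys j)"
      by (rule interp_attained)
    have "u * interp \<alpha> x + v * interp \<alpha> y \<le>
        u * (\<alpha> j + slope ys \<alpha> j * (x - pt ys j)) + v * (\<alpha> j + slope ys \<alpha> j * (y - pt ys j))"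
      using uv interp_le[OF j(1)] by (intro add_mono mult_left_mono) auto
    also have "\<dots> = (u + v) * (\<alpha> j - slope ys \<alpha> j * pt ys j) + slope ys \<alpha> j * (u * x + v * y)"
      by (simp add: algebra_simps)
    also have "\<dots> = interp \<alpha> (u *\<^sub>R x + v *\<^sub>R y)"
      using uv j(2) by (simp add: algebra_simps)
    finally show "u * interp \<alpha> x + v * interp \<alpha> y \<le> interp \<alpha> (u *\<^sub>R x + v *\<^sub>R y)" .
  qed simp
  moreover have "L-lipschitz_on {0..b} (interp \<alpha>)"
  proof (rule lipschitz_onI)
    have "interp \<alpha> x - interp \<alpha> y \<le> L * \<bar>x - y\<bar>" for x y
    proof -
      obtain j where j: "j \<in> {1..N-1}" "interp \<alpha> y = \<alpha> j + slope ys \<alpha> j * (y - pt ys j)"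
        by (rule interp_attained)
      have s: "0 \<le> slope ys \<alpha> j" "slope ys \<alpha> j \<le> L"
        using slope_nonneg[OF \<alpha>, of j] slope_le[OF \<alpha>, of j] j N by auto
      have "interp \<alpha> x - interp \<alpha> y \<le> slope ys \<alpha> j * (x - y)"
        using interp_le[OF j(1), of \<alpha> x] j by (simp add: algebra_simps)
      also have "\<dots> \<le> slope ys \<alpha> j * \<bar>x - y\<bar>" using s by (intro mult_left_mono) auto
      also have "\<dots> \<le> L * \<bar>x - y\<bar>" using s by (intro mult_right_mono) auto
      finally show ?thesis .
    qed
    from this[of x y for x y] this[of y x for x y]
    show "dist (interp \<alpha> x) (interp \<alpha> y) \<le> L * dist x y" for x y
      by (fastforce simp: dist_real_def abs_le_iff abs_minus_commute)
  qed (use \<open>0 < L\<close> in simp)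
  moreover have "interp \<alpha> 0 = 0" "interp \<alpha> b = 1"
    using interp_pt[OF \<alpha>, of 1] interp_pt[OF \<alpha>, of N] two_points first_point last_point \<alpha> N
    by (auto simp: utility_cone_def Let_def)
  ultimately show ?thesis by (simp add: U_c_def)
qed

lemma restrict_mem_cone:
  assumes u: "u \<in> U_c b L"
  shows "restrict (\<lambda>j. u (pt ys j)) {1..N} \<in> utility_cone L ys"
    and "restrict (\<lambda>j. u (pt ys j)) {1..N} N = 1"
proof -
  let ?\<alpha> = "restrict (\<lambda>j. u (pt ys j)) {1..N}"
  have slope: "slope ys ?\<alpha> j = (u (pt ys (j + 1)) - u (pt ys j)) / (pt ys (j + 1) - pt ys j)"
    if "1 \<le> j" "j < N" for j using that by (simp add: slope_def)
  have convex: "convex_on {0..b} (\<lambda>x. - u x)" and mono: "mono_on {0..b} u"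
    and lipschitz: "L-lipschitz_on {0..b} u" and ends: "u 0 = 0" "u b = 1"
    using u by (auto simp: U_c_def concave_on_def)
  show N: "?\<alpha> N = 1" using two_points last_point ends by auto
  have "slope ys ?\<alpha> (j + 1) \<le> slope ys ?\<alpha> j" if j: "j \<in> {1..N-2}" for j
  proof -
    have lt: "pt ys j < pt ys (j + 1)" "pt ys (j + 1) < pt ys (j + 2)"
      using pt_less[of j "j + 1"] pt_less[of "j + 1" "j + 2"] j by auto
    have mem: "pt ys j \<in> {0..b}" "pt ys (j + 2) \<in> {0..b}"
      using pt_mem[of j] pt_mem[of "j + 2"] j by auto
    have flip: "(- u x - - u y) / (x - y) = - ((u y - u x) / (y - x))" for x y
      by (metis minus_diff_eq minus_divide_left minus_divide_right minus_diff_minus)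
    have "(u (pt ys (j + 2)) - u (pt ys (j + 1))) / (pt ys (j + 2) - pt ys (j + 1))
        \<le> (u (pt ys (j + 1)) - u (pt ys j)) / (pt ys (j + 1) - pt ys j)"
      using order_trans[OF convex_on_slope_le[OF convex mem lt]] unfolding flip by simp
    moreover have "j + 1 < N" using j by auto
    ultimately show ?thesis using slope[of j] slope[of "j + 1"] j by simp
  qed
  moreover have "slope ys ?\<alpha> 1 \<le> L * ?\<alpha> N"
  proof -
    have "u (pt ys 2) - u (pt ys 1) \<le> L * (pt ys 2 - pt ys 1)"
      using lipschitz_onD[OF lipschitz, of "pt ys 2" "pt ys 1"] pt_mem[of 1] pt_mem[of 2]
        pt_less[of 1 2] two_points by (auto simp: dist_real_def)
    then show ?thesis using slope[of 1] pt_less[of 1 2] two_points N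
      by (simp add: divide_le_eq numeral_2_eq_2)
  qed
  moreover have "0 \<le> slope ys ?\<alpha> (N - 1)"
  proof -
    have "u (pt ys (N - 1)) \<le> u (pt ys N)"
      using pt_less[of "N - 1" N] two_points pt_mem[of "N - 1"] pt_mem[of N]
      by (intro mono_onD[OF mono]) auto
    then show ?thesis using slope[of "N - 1"] pt_less[of "N - 1" N] two_points by simp
  qed
  ultimately show "?\<alpha> \<in> utility_cone L ys"
    using two_points first_point ends by (auto simp: utility_cone_def Let_def vecs_def)
qed

lemma sum_pt: "(\<Sum>y\<in>set ys. f y) = (\<Sum>j=1..N. f (pt ys j))"
proof (rule sum.reindex_bij_betw[symmetric])
  show "bij_betw (pt ys) {1..N} (set ys)"
    unfolding bij_betw_def
  proof
    show "inj_on (pt ys) {1..N}"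
      by (rule linorder_inj_onI) (use pt_less in force)+
    have "(\<lambda>j. j - 1) ` {1..N} = {0..<N}"
      by (force simp: image_iff intro: bexI[of _ "Suc _"])
    then have "pt ys ` {1..N} = (!) ys ` {0..<N}"
      unfolding pt_def by (metis image_image)
    then show "pt ys ` {1..N} = set ys" using nth_image[of N ys] by simp
  qed
qed

lemma expectation_eq:
  assumes "set_pmf M \<subseteq> set ys"
  shows "measure_pmf.expectation M u = (\<Sum>j=1..N. pmf M (pt ys j) * u (pt ys j))"
proof -
  have "measure_pmf.expectation M u = (\<Sum>y\<in>set ys. pmf M y * u y)"
    using integral_measure_pmf[of "set ys" M u] assms by auto
  then show ?thesis by (simp only: sum_pt)
qed

end

lemma knots_grid:
  assumes "0 < b"
    and "\<And>k. k \<in> {1..K} \<Longrightarrow> finite (set_pmf (W k)) \<and> set_pmf (W k) \<subseteq> {0..b}"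
    and "\<And>k. k \<in> {1..K} \<Longrightarrow> finite (set_pmf (Y k)) \<and> set_pmf (Y k) \<subseteq> {0..b}"
  shows "knots (grid b K W Y) b"
    and "set (grid b K W Y) = {0, b} \<union> (\<Union>k\<in>{1..K}. set_pmf (W k)) \<union> (\<Union>k\<in>{1..K}. set_pmf (Y k))"
proof -
  let ?S = "{0, b} \<union> (\<Union>k\<in>{1..K}. set_pmf (W k)) \<union> (\<Union>k\<in>{1..K}. set_pmf (Y k))"
  let ?ys = "grid b K W Y"
  have S: "finite ?S" using assms(2,3) by simp
  have "(\<Union>k\<in>{1..K}. set_pmf (W k)) \<subseteq> {0..b}" "(\<Union>k\<in>{1..K}. set_pmf (Y k)) \<subseteq> {0..b}"
    by (intro UN_least conjunct2[OF assms(2)] conjunct2[OF assms(3)], assumption)+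
  then have S_sub: "?S \<subseteq> {0..b}" using assms(1) by simp
  show set: "set ?ys = ?S" unfolding grid_def using S by (rule set_sorted_list_of_set)
  have sorted: "sorted_wrt (<) ?ys" unfolding grid_def by simp
  have "distinct ?ys" unfolding grid_def by simp
  then have "length ?ys = card ?S" using set by (metis distinct_card)
  moreover have "card {0, b} \<le> card ?S" by (intro card_mono S) auto
  ultimately have two: "2 \<le> length ?ys" using assms(1) by simp
  have le: "?ys ! i \<le> ?ys ! j" if "i \<le> j" "j < length ?ys" for i j
    using sorted that sorted_wrt_nth_less[OF sorted, of i j] by (cases "i = j") auto
  obtain i where i: "i < length ?ys" "?ys ! i = 0"
    using set by (metis in_set_conv_nth UnI1 insertI1)
  obtain j where j: "j < length ?ys" "?ys ! j = b"
    using set by (metis in_set_conv_nth UnI1 insertI1 insertI2)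
  have mem: "?ys ! n \<in> {0..b}" if "n < length ?ys" for n
    using that set S_sub nth_mem by blast
  have "?ys ! 0 = 0" using le[of 0 i] i mem[of 0] two by force
  moreover have "?ys ! (length ?ys - 1) = b"
    using le[of j "length ?ys - 1"] j mem[of "length ?ys - 1"] two by force
  ultimately show "knots ?ys b"
    using sorted two by unfold_locales (auto simp: pt_def)
qed

lemma ln_one_plus_exp_ge:
  fixes t :: real
  shows "ln 2 - t / 2 \<le> ln (1 + exp (- t))"
proof -
  have "0 \<le> (1 - exp (- t / 2))\<^sup>2" by simp
  also have "\<dots> = 1 + exp (- t) - 2 * exp (- t / 2)"
    by (simp add: power2_eq_square algebra_simps flip: exp_add)
  finally have "ln (2 * exp (- t / 2)) \<le> ln (1 + exp (- t))"
    by (intro ln_mono) auto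
  then show ?thesis by (simp add: ln_mult)
qed

lemma log_likelihood_le:
  fixes m :: "'a \<Rightarrow> real"
  shows "- (\<Sum>k\<in>A. ln (1 + exp (- m k))) \<le> - (\<Sum>k\<in>A. ln 2) + (\<Sum>k\<in>A. m k) / 2"
proof -
  have "(\<Sum>k\<in>A. ln 2 - m k / 2) \<le> (\<Sum>k\<in>A. ln (1 + exp (- m k)))"
    by (intro sum_mono ln_one_plus_exp_ge)
  then show ?thesis by (simp add: sum_subtractf sum_divide_distrib)
qed

lemma log_likelihood_increases:
  fixes m :: "'a \<Rightarrow> real"
  assumes "0 < (\<Sum>k\<in>A. m k)"
  obtains d where "0 < d"
    and "\<And>s. 0 < s \<Longrightarrow> s < d \<Longrightarrow> - (\<Sum>k\<in>A. ln 2) < - (\<Sum>k\<in>A. ln (1 + exp (- (s * m k))))"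
proof -
  let ?f = "\<lambda>s. - (\<Sum>k\<in>A. ln (1 + exp (- (s * m k))))"
  have "((\<lambda>s. ln (1 + exp (- (s * m k)))) has_real_derivative - m k / 2) (at 0)" for k
    by (auto intro!: derivative_eq_intros)
  then have "(?f has_real_derivative - (\<Sum>k\<in>A. - m k / 2)) (at 0)"
    by (intro DERIV_minus DERIV_sum)
  moreover have "0 < - (\<Sum>k\<in>A. - m k / 2)"
    using assms by (simp add: sum_negf flip: sum_divide_distrib)
  ultimately obtain d where "0 < d" "\<forall>h>0. h < d \<longrightarrow> ?f 0 < ?f (0 + h)"
    using DERIV_pos_inc_right by blast
  then show ?thesis by (intro that[of d]) auto
qed

definition margin :: "(nat \<Rightarrow> real pmf) \<Rightarrow> (nat \<Rightarrow> real pmf) \<Rightarrow> (nat \<Rightarrow> real) \<Rightarrow> real list \<Rightarrow>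
    (nat \<Rightarrow> real) \<Rightarrow> nat \<Rightarrow> real" where
  "margin W Y Z ys \<alpha> k = (\<Sum>j=1..length ys. Z k * pdiff W Y ys k j * \<alpha> j)"

lemma P_objective_eq:
  "P_objective K W Y Z ys (\<alpha>, \<beta>, \<gamma>) = - (\<Sum>k=1..K. ln (1 + exp (- margin W Y Z ys \<alpha> k)))"
  by (simp add: P_objective_def margin_def sum_negf)

lemma pbar_dot_eq: "pbar_dot K W Y Z ys \<alpha> = (\<Sum>k=1..K. margin W Y Z ys \<alpha> k)"
  unfolding pbar_dot_def pbar_def margin_def sum_distrib_right by (rule sum.swap)

lemma margin_scaled:
  "margin W Y Z ys (restrict (\<lambda>j. s * \<alpha> j) {1..length ys}) k = s * margin W Y Z ys \<alpha> k"
  unfolding margin_def sum_distrib_left by (rule sum.cong) auto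

lemma continuous_on_margin: "continuous_on UNIV (\<lambda>\<alpha>. margin W Y Z ys \<alpha> k)"
  unfolding margin_def by (intro continuous_intros continuous_on_product_coordinates)

lemma is_arg_max_iff:
  fixes f :: "'a \<Rightarrow> 'b::linorder"
  shows "is_arg_max f P x \<longleftrightarrow> P x \<and> (\<forall>y. P y \<longrightarrow> f y \<le> f x)"
  by (auto simp: is_arg_max_def not_less)

theorem proposition2:
  fixes b L c :: real and K :: nat
    and W Y :: "nat \<Rightarrow> real pmf" and Z :: "nat \<Rightarrow> real" and ys :: "real list"
  assumes "b > 0" and "L > 0" and "c > 0"
    and "U_c b L \<noteq> {}"
    and "\<And>k. k \<in> {1..K} \<Longrightarrow> finite (set_pmf (W k)) \<and> set_pmf (W k) \<subseteq> {0..b}"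
    and "\<And>k. k \<in> {1..K} \<Longrightarrow> finite (set_pmf (Y k)) \<and> set_pmf (Y k) \<subseteq> {0..b}"
    and "\<And>k. k \<in> {1..K} \<Longrightarrow> Z k \<in> {1, -1}"
    and "ys = grid b K W Y"
  shows
    "(\<exists>x. P_optimal L c K W Y Z ys x) \<and>
     (\<exists>\<alpha>. is_arg_max (pbar_dot K W Y Z ys) (\<lambda>\<alpha>. \<alpha> \<in> \<A> L ys) \<alpha>) \<and>
     ((\<exists>\<alpha> \<beta>. P_optimal L c K W Y Z ys (\<alpha>, \<beta>, 0)) \<longleftrightarrow>
        \<not> (\<exists>u\<in>U_c b L. (\<Sum>k=1..K. Z k * (measure_pmf.expectation (W k) u
                                            - measure_pmf.expectation (Y k) u)) > 0)) \<and>
     ((\<exists>\<alpha> \<beta>. P_optimal L c K W Y Z ys (\<alpha>, \<beta>, 0)) \<longleftrightarrow> max_pbar L K W Y Z ys \<le> 0) \<and>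
     (\<not> (\<exists>\<alpha> \<beta>. P_optimal L c K W Y Z ys (\<alpha>, \<beta>, 0)) \<longleftrightarrow> max_pbar L K W Y Z ys > 0) \<and>
     ((\<forall>\<alpha> \<beta> \<gamma>. P_optimal L c K W Y Z ys (\<alpha>, \<beta>, \<gamma>) \<longrightarrow> \<gamma> > 0) \<longleftrightarrow> max_pbar L K W Y Z ys > 0) \<and>
     ((\<forall>j\<in>{1..length ys}. pbar K W Y Z ys j \<le> 0) \<longrightarrow>
        (\<exists>\<alpha> \<beta>. P_optimal L c K W Y Z ys (\<alpha>, \<beta>, 0)))"
proof -
  let ?N = "length ys" and ?dot = "pbar_dot K W Y Z ys" and ?m = "margin W Y Z ys"
  let ?opt = "P_optimal L c K W Y Z ys" and ?obj = "P_objective K W Y Z ys"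
  let ?gain = "\<lambda>u. \<Sum>k=1..K. Z k * (measure_pmf.expectation (W k) u - measure_pmf.expectation (Y k) u)"
  interpret knots ys b
    unfolding assms(8) by (rule knots_grid(1)) (fact assms)+
  have set_ys: "set ys = {0, b} \<union> (\<Union>k\<in>{1..K}. set_pmf (W k)) \<union> (\<Union>k\<in>{1..K}. set_pmf (Y k))"
    unfolding assms(8) by (rule knots_grid(2)) (fact assms)+
  obtain u0 where u0: "u0 \<in> U_c b L" using assms(4) by auto
  have "1 \<le> L * b"
    using lipschitz_onD[of L "{0..b}" u0 b 0] u0 assms(1) by (auto simp: U_c_def)
  note A = mem_A_iff[OF this]

  have A_of_u: "restrict (\<lambda>j. u (pt ys j)) {1..?N} \<in> \<A> L ys" if "u \<in> U_c b L" for u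
    using restrict_mem_cone[OF that] A by blast
  have gain: "?gain u = ?dot (\<lambda>j. u (pt ys j))" for u
  proof -
    have "Z k * (measure_pmf.expectation (W k) u - measure_pmf.expectation (Y k) u)
        = ?m (\<lambda>j. u (pt ys j)) k" if "k \<in> {1..K}" for k
    proof -
      have "set_pmf (W k) \<subseteq> set ys" "set_pmf (Y k) \<subseteq> set ys"
        using that unfolding set_ys by auto
      then show ?thesis
        by (simp add: expectation_eq margin_def pdiff_def sum_distrib_left algebra_simps
            flip: sum_subtractf)
    qed
    then show ?thesis unfolding pbar_dot_eq by (intro sum.cong) auto
  qed
  have dot_cong: "?dot \<alpha> = ?dot \<alpha>'" if "\<And>j. j \<in> {1..?N} \<Longrightarrow> \<alpha> j = \<alpha>' j" for \<alpha> \<alpha>'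
    using that by (simp add: pbar_dot_def)
  have gain_iff: "(\<exists>u\<in>U_c b L. 0 < ?gain u) \<longleftrightarrow> (\<exists>\<alpha>\<in>\<A> L ys. 0 < ?dot \<alpha>)"
  proof
    assume "\<exists>u\<in>U_c b L. 0 < ?gain u"
    then obtain u where u: "u \<in> U_c b L" "0 < ?gain u" by blast
    have "0 < ?dot (restrict (\<lambda>j. u (pt ys j)) {1..?N})"
      using u(2) unfolding gain by (subst dot_cong[where \<alpha>' = "\<lambda>j. u (pt ys j)"]) auto
    then show "\<exists>\<alpha>\<in>\<A> L ys. 0 < ?dot \<alpha>" using A_of_u[OF u(1)] by blast
  next
    assume "\<exists>\<alpha>\<in>\<A> L ys. 0 < ?dot \<alpha>"
    then obtain \<alpha> where \<alpha>: "\<alpha> \<in> \<A> L ys" "0 < ?dot \<alpha>" by blast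
    have "?gain (interp \<alpha>) = ?dot \<alpha>"
      unfolding gain using \<alpha>(1) A interp_pt by (intro dot_cong) blast
    then show "\<exists>u\<in>U_c b L. 0 < ?gain u"
      using \<alpha> A interp_mem_U_c assms(2) by (intro bexI[of _ "interp \<alpha>"]) auto
  qed

  have dot_max: "\<exists>\<alpha>. is_arg_max ?dot (\<lambda>\<alpha>. \<alpha> \<in> \<A> L ys) \<alpha>"
  proof -
    have "\<A> L ys = utility_cone L ys \<inter> {\<alpha>. \<alpha> ?N \<in> {1}}" using A by auto
    then have "compact (\<A> L ys)" using compact_cone_slice[of "{1}"] by simp
    moreover have "\<A> L ys \<noteq> {}" using A_of_u[OF u0] by blast
    moreover have "continuous_on (\<A> L ys) ?dot"
      unfolding pbar_dot_eq
      by (intro continuous_intros continuous_on_subset[OF continuous_on_margin]) auto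
    ultimately show ?thesis
      using continuous_attains_sup[of "\<A> L ys" ?dot] by (auto simp: is_arg_max_iff)
  qed
  then obtain \<alpha>0 where \<alpha>0: "\<alpha>0 \<in> \<A> L ys" "\<And>\<alpha>. \<alpha> \<in> \<A> L ys \<Longrightarrow> ?dot \<alpha> \<le> ?dot \<alpha>0"
    by (auto simp: is_arg_max_iff)
  have max_eq: "max_pbar L K W Y Z ys = ?dot \<alpha>0"
    unfolding max_pbar_def using \<alpha>0 by (intro Greatest_equality) auto
  have max_iff: "max_pbar L K W Y Z ys \<le> 0 \<longleftrightarrow> \<not> (\<exists>\<alpha>\<in>\<A> L ys. 0 < ?dot \<alpha>)"
    unfolding max_eq using \<alpha>0 by (meson leD leI order_trans)

  let ?slice = "utility_cone L ys \<inter> {\<alpha>. \<alpha> ?N \<in> {0..c}}"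
  let ?LL = "\<lambda>\<alpha>. - (\<Sum>k=1..K. ln (1 + exp (- ?m \<alpha> k)))"
  define point where "point \<alpha> = (\<alpha>, restrict (slope ys \<alpha>) {1..?N-1}, \<alpha> ?N)" for \<alpha>
  have feasible_iff: "x \<in> P_feasible L c ys \<longleftrightarrow> (\<exists>\<alpha>\<in>?slice. x = point \<alpha>)" for x
    by (cases x) (auto simp: mem_P_feasible_iff point_def)
  have obj: "?obj (point \<alpha>) = ?LL \<alpha>" for \<alpha>
    unfolding point_def by (rule P_objective_eq)
  have opt_iff: "?opt x \<longleftrightarrow> (\<exists>\<alpha>\<in>?slice. x = point \<alpha> \<and> (\<forall>\<alpha>'\<in>?slice. ?LL \<alpha>' \<le> ?LL \<alpha>))" for x
  proof -
    have "?opt x \<longleftrightarrow> (\<exists>\<alpha>\<in>?slice. x = point \<alpha>) \<and> (\<forall>\<alpha>'\<in>?slice. ?obj (point \<alpha>') \<le> ?obj x)"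
      unfolding P_optimal_def is_arg_max_iff feasible_iff by blast
    then show ?thesis unfolding obj using obj by metis
  qed

  define zero where "zero = restrict (\<lambda>_. 0::real) {1..?N}"
  have zero: "zero \<in> ?slice"
    using zero_mem_cone[of L] assms(3) two_points by (auto simp: zero_def)
  have LL_zero: "?LL \<alpha> = - (\<Sum>k=1..K. ln 2)" if "\<And>j. j \<in> {1..?N} \<Longrightarrow> \<alpha> j = 0" for \<alpha>
    using that by (simp add: margin_def)

  have opt_ex: "\<exists>x. ?opt x"
  proof -
    have "1 + exp (- ?m \<alpha> k) \<noteq> 0" for \<alpha> k
      by (metis add_pos_pos exp_gt_zero less_irrefl zero_less_one)
    then have "continuous_on ?slice ?LL"
      by (intro continuous_intros continuous_on_subset[OF continuous_on_margin]) auto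
    moreover have "compact ?slice" using compact_cone_slice[of "{0..c}"] by simp
    ultimately obtain \<alpha> where "\<alpha> \<in> ?slice" "\<forall>\<alpha>'\<in>?slice. ?LL \<alpha>' \<le> ?LL \<alpha>"
      using continuous_attains_sup[of ?slice ?LL] zero by blast
    then show ?thesis unfolding opt_iff by blast
  qed

  have zero_opt_iff: "(\<exists>\<alpha> \<beta>. ?opt (\<alpha>, \<beta>, 0)) \<longleftrightarrow> \<not> (\<exists>\<alpha>\<in>\<A> L ys. 0 < ?dot \<alpha>)"
  proof
    assume "\<exists>\<alpha> \<beta>. ?opt (\<alpha>, \<beta>, 0)"
    then obtain \<alpha>1 where \<alpha>1: "\<alpha>1 \<in> ?slice" "\<alpha>1 ?N = 0" "\<And>\<alpha>'. \<alpha>' \<in> ?slice \<Longrightarrow> ?LL \<alpha>' \<le> ?LL \<alpha>1"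
      unfolding opt_iff point_def by auto
    have LL1: "?LL \<alpha>1 = - (\<Sum>k=1..K. ln 2)"
      using cone_eq_zero[of \<alpha>1 L] \<alpha>1(1,2) by (intro LL_zero) blast
    show "\<not> (\<exists>\<alpha>\<in>\<A> L ys. 0 < ?dot \<alpha>)"
    proof
      assume "\<exists>\<alpha>\<in>\<A> L ys. 0 < ?dot \<alpha>"
      then obtain \<alpha> where \<alpha>: "\<alpha> \<in> utility_cone L ys" "\<alpha> ?N = 1" "0 < (\<Sum>k=1..K. ?m \<alpha> k)"
        using A by (auto simp: pbar_dot_eq)
      obtain d where d: "0 < d"
        "\<And>s. 0 < s \<Longrightarrow> s < d \<Longrightarrow> - (\<Sum>k=1..K. ln 2) < - (\<Sum>k=1..K. ln (1 + exp (- (s * ?m \<alpha> k))))"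
        using log_likelihood_increases[OF \<alpha>(3)] by blast
      define s where "s = min c (d / 2)"
      have s: "0 < s" "s < d" "s \<le> c" using d(1) assms(3) by (auto simp: s_def)
      let ?\<alpha>' = "restrict (\<lambda>j. s * \<alpha> j) {1..?N}"
      have "?\<alpha>' \<in> ?slice"
        using scaled_mem_cone[OF \<alpha>(1), of s] s \<alpha>(2) two_points by auto
      then have "?LL ?\<alpha>' \<le> ?LL \<alpha>1" by (rule \<alpha>1(3))
      then show False using d(2)[OF s(1,2)] LL1 unfolding margin_scaled by linarith
    qed
  next
    assume neg: "\<not> (\<exists>\<alpha>\<in>\<A> L ys. 0 < ?dot \<alpha>)"
    have "?LL \<alpha> \<le> ?LL zero" if \<alpha>: "\<alpha> \<in> ?slice" for \<alpha>
    proof (cases "\<alpha> ?N = 0")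
      case True
      then have "?LL \<alpha> = - (\<Sum>k=1..K. ln 2)"
        using cone_eq_zero[of \<alpha> L] \<alpha> by (intro LL_zero) blast
      moreover have "?LL zero = - (\<Sum>k=1..K. ln 2)" by (rule LL_zero) (simp add: zero_def)
      ultimately show ?thesis by linarith
    next
      case False
      let ?s = "inverse (\<alpha> ?N)"
      have s: "0 < ?s" using False \<alpha> by auto
      have "restrict (\<lambda>j. ?s * \<alpha> j) {1..?N} \<in> \<A> L ys"
        unfolding A using scaled_mem_cone[of \<alpha> L ?s] \<alpha> s False two_points by auto
      then have "?dot (restrict (\<lambda>j. ?s * \<alpha> j) {1..?N}) \<le> 0" using neg by (meson not_less)
      then have "?s * (\<Sum>k=1..K. ?m \<alpha> k) \<le> 0"
        unfolding pbar_dot_eq margin_scaled sum_distrib_left .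
      then have "(\<Sum>k=1..K. ?m \<alpha> k) \<le> 0" using s by (simp only: mult_le_0_iff) auto
      moreover have "?LL zero = - (\<Sum>k=1..K. ln 2)" by (rule LL_zero) (simp add: zero_def)
      ultimately show ?thesis using log_likelihood_le[of "?m \<alpha>" "{1..K}"] by linarith
    qed
    then have "?opt (point zero)" unfolding opt_iff using zero by blast
    moreover have "zero ?N = 0" using two_points by (simp add: zero_def)
    ultimately show "\<exists>\<alpha> \<beta>. ?opt (\<alpha>, \<beta>, 0)" unfolding point_def by metis
  qed

  have pos_iff: "(\<forall>\<alpha> \<beta> \<gamma>. ?opt (\<alpha>, \<beta>, \<gamma>) \<longrightarrow> 0 < \<gamma>) \<longleftrightarrow> \<not> (\<exists>\<alpha> \<beta>. ?opt (\<alpha>, \<beta>, 0))"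
  proof -
    have "0 \<le> \<gamma>" if "?opt (\<alpha>, \<beta>, \<gamma>)" for \<alpha> \<beta> \<gamma>
      using that unfolding opt_iff point_def by auto
    then show ?thesis by (metis less_irrefl order_le_less)
  qed

  have nonpos: "\<not> (\<exists>\<alpha>\<in>\<A> L ys. 0 < ?dot \<alpha>)" if "\<forall>j\<in>{1..?N}. pbar K W Y Z ys j \<le> 0"
  proof -
    have "?dot \<alpha> \<le> 0" if "\<alpha> \<in> \<A> L ys" for \<alpha>
      unfolding pbar_dot_def
      using value_bounds(1)[of \<alpha> L] that A \<open>\<forall>j\<in>{1..?N}. pbar K W Y Z ys j \<le> 0\<close>
      by (intro sum_nonpos mult_nonpos_nonneg) auto
    then show ?thesis by (meson not_less)
  qed

  show ?thesis
    using opt_ex dot_max zero_opt_iff gain_iff max_iff pos_iff nonpos not_le by blast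
qed

end
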